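(* Suppose that $F : \mathsf C \to \mathsf D$ is a separable functor. Let $I, Z, T$ be objects of $\mathsf C$. (a) If $F(I)$ is initial in $\mathsf D$, then $I$ is initial in $\mathsf C$. (b) If $F(T)$ is terminal in $\mathsf D$, then $T$ is terminal in $\mathsf C$. (c) If $F(Z)$ is a zero object in $\mathsf D$, then $Z$ is a zero object in $\mathsf C$.
   Context: Functors are covariant. A functor $F:\mathsf C\to\mathsf D$ is separable if for all objects $M,N$ of $\mathsf C$ there is a function $R_{M,N}:\mathrm{Hom}_{\mathsf D}(F(M),F(N))\to\mathrm{Hom}_{\mathsf C}(M,N)$ such that (SF1) $R_{M,N}(F(h))=h$ for all $h:M\to N$ in $\mathsf C$; and (SF2) for all $h:M\to M'$, $g:N\to N'$ in $\mathsf C$ and $h':F(M)\to F(N)$, $g':F(M')\to F(N')$ in $\mathsf D$, if $F(g)h'=g'F(h)$ then $g\,R_{M,N}(h')=R_{M',N'}(g')\,h$. A zero object is an object that is both initial and terminal. *)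

theory Defs
  imports Main "HOL-Library.FuncSet"
begin

text \<open>
  Categories are given by carrier sets of objects and arrows inside arbitrary types; the operations
  matter only on the carriers. \<open>g \<odot>\<^bsub>C\<^esub> f\<close> is \<open>g\<close> after \<open>f\<close>.
\<close>

record ('o, 'a) cat =
  Obj :: "'o set"
  Arr :: "'a set"
  Dom :: "'a \<Rightarrow> 'o"
  Cod :: "'a \<Rightarrow> 'o"
  Ident :: "'o \<Rightarrow> 'a"
  Comp :: "'a \<Rightarrow> 'a \<Rightarrow> 'a"  (infixr "\<odot>\<index>" 70)

definition Hom :: "('o, 'a) cat \<Rightarrow> 'o \<Rightarrow> 'o \<Rightarrow> 'a set" where
  "Hom C X Y = {f \<in> Arr C. Dom C f = X \<and> Cod C f = Y}"

locale category =
  fixes C :: "('o, 'a) cat" (structure)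
  assumes Dom_closed: "f \<in> Arr C \<Longrightarrow> Dom C f \<in> Obj C"
    and Cod_closed: "f \<in> Arr C \<Longrightarrow> Cod C f \<in> Obj C"
    and Ident_in_Hom: "X \<in> Obj C \<Longrightarrow> Ident C X \<in> Hom C X X"
    and Comp_in_Hom: "\<lbrakk>f \<in> Hom C X Y; g \<in> Hom C Y Z\<rbrakk> \<Longrightarrow> g \<odot> f \<in> Hom C X Z"
    and Comp_Ident_right: "f \<in> Hom C X Y \<Longrightarrow> f \<odot> Ident C X = f"
    and Comp_Ident_left: "f \<in> Hom C X Y \<Longrightarrow> Ident C Y \<odot> f = f"
    and Comp_assoc: "\<lbrakk>f \<in> Hom C W X; g \<in> Hom C X Y; h \<in> Hom C Y Z\<rbrakk>
      \<Longrightarrow> (h \<odot> g) \<odot> f = h \<odot> (g \<odot> f)"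

record ('o, 'a, 'p, 'b) fctr =
  Omap :: "'o \<Rightarrow> 'p"
  Amap :: "'a \<Rightarrow> 'b"

locale covariant_functor = source: category C + target: category D
  for C :: "('o, 'a) cat" and D :: "('p, 'b) cat" +
  fixes F :: "('o, 'a, 'p, 'b) fctr"
  assumes Omap_closed: "X \<in> Obj C \<Longrightarrow> Omap F X \<in> Obj D"
    and Amap_in_Hom: "f \<in> Hom C X Y \<Longrightarrow> Amap F f \<in> Hom D (Omap F X) (Omap F Y)"
    and Amap_Ident: "X \<in> Obj C \<Longrightarrow> Amap F (Ident C X) = Ident D (Omap F X)"
    and Amap_Comp: "\<lbrakk>f \<in> Hom C X Y; g \<in> Hom C Y Z\<rbrakk>
      \<Longrightarrow> Amap F (g \<odot>\<^bsub>C\<^esub> f) = Amap F g \<odot>\<^bsub>D\<^esub> Amap F f"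

text \<open>
  The family \<open>R\<close> is indexed by objects of the source category, since \<open>F\<close> need not be injective on
  objects.
\<close>

definition separable_functor ::
  "('o, 'a) cat \<Rightarrow> ('p, 'b) cat \<Rightarrow> ('o, 'a, 'p, 'b) fctr \<Rightarrow> bool" where
  "separable_functor C D F \<longleftrightarrow>
     covariant_functor C D F \<and>
     (\<exists>R :: 'o \<Rightarrow> 'o \<Rightarrow> 'b \<Rightarrow> 'a.
        (\<forall>M\<in>Obj C. \<forall>N\<in>Obj C. R M N \<in> Hom D (Omap F M) (Omap F N) \<rightarrow> Hom C M N) \<and>
        (\<forall>M\<in>Obj C. \<forall>N\<in>Obj C. \<forall>h\<in>Hom C M N. R M N (Amap F h) = h) \<and>
        (\<forall>M\<in>Obj C. \<forall>M'\<in>Obj C. \<forall>N\<in>Obj C. \<forall>N'\<in>Obj C.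
           \<forall>h\<in>Hom C M M'. \<forall>g\<in>Hom C N N'.
           \<forall>h'\<in>Hom D (Omap F M) (Omap F N). \<forall>g'\<in>Hom D (Omap F M') (Omap F N').
             Amap F g \<odot>\<^bsub>D\<^esub> h' = g' \<odot>\<^bsub>D\<^esub> Amap F h \<longrightarrow>
             g \<odot>\<^bsub>C\<^esub> R M N h' = R M' N' g' \<odot>\<^bsub>C\<^esub> h))"

definition initial_object :: "('o, 'a) cat \<Rightarrow> 'o \<Rightarrow> bool" where
  "initial_object C I \<longleftrightarrow> I \<in> Obj C \<and> (\<forall>X\<in>Obj C. \<exists>!f. f \<in> Hom C I X)"

definition terminal_object :: "('o, 'a) cat \<Rightarrow> 'o \<Rightarrow> bool" where
  "terminal_object C T \<longleftrightarrow> T \<in> Obj C \<and> (\<forall>X\<in>Obj C. \<exists>!f. f \<in> Hom C X T)"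

definition zero_object :: "('o, 'a) cat \<Rightarrow> 'o \<Rightarrow> bool" where
  "zero_object C Z \<longleftrightarrow> initial_object C Z \<and> terminal_object C Z"

end

theory Submission
  imports Defs
begin

text \<open>
  By (SF1) the map \<open>R M N\<close> is a left inverse of the action of \<open>F\<close> on \<open>Hom C M N\<close>, so \<open>Hom C M N\<close>
  is a retract of \<open>Hom D (Omap F M) (Omap F N)\<close>. A retract of a one-element set has exactly one
  element: the retraction supplies an element, and injectivity of its section makes it unique.
  Being initial or terminal says that certain hom sets have exactly one element, so both
  properties are reflected by \<open>F\<close>, and hence so is being a zero object.
\<close>

lemma separable_functor_reflects_unique_arrow:
  assumes sep: "separable_functor C D F"
    and M: "M \<in> Obj C" and N: "N \<in> Obj C"
    and unique: "\<exists>!f. f \<in> Hom D (Omap F M) (Omap F N)"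
  shows "\<exists>!f. f \<in> Hom C M N"
proof -
  interpret covariant_functor C D F
    using sep by (simp add: separable_functor_def)
  from sep obtain R
    where R_family: "\<forall>M\<in>Obj C. \<forall>N\<in>Obj C. R M N \<in> Hom D (Omap F M) (Omap F N) \<rightarrow> Hom C M N"
      and SF1: "\<forall>M\<in>Obj C. \<forall>N\<in>Obj C. \<forall>h\<in>Hom C M N. R M N (Amap F h) = h"
    unfolding separable_functor_def by (elim conjE exE)
  have R_in: "R M N \<in> Hom D (Omap F M) (Omap F N) \<rightarrow> Hom C M N"
    using R_family M N by simp
  have R_retract: "R M N (Amap F h) = h" if "h \<in> Hom C M N" for h
    using SF1 M N that by simp
  from unique obtain u where u: "u \<in> Hom D (Omap F M) (Omap F N)"
    by blast
  show ?thesis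
  proof (rule ex1I)
    show "R M N u \<in> Hom C M N"
      using R_in u by (rule funcset_mem)
  next
    fix f
    assume f: "f \<in> Hom C M N"
    then have "Amap F f = u"
      using unique u Amap_in_Hom by blast
    then show "f = R M N u"
      using R_retract[OF f] by simp
  qed
qed

lemma separable_functor_reflects_initial_object:
  assumes sep: "separable_functor C D F" and I: "I \<in> Obj C"
    and initial: "initial_object D (Omap F I)"
  shows "initial_object C I"
proof -
  interpret covariant_functor C D F
    using sep by (simp add: separable_functor_def)
  show ?thesis
    using separable_functor_reflects_unique_arrow[OF sep I] initial I Omap_closed
    by (simp add: initial_object_def)
qed

lemma separable_functor_reflects_terminal_object:
  assumes sep: "separable_functor C D F" and T: "T \<in> Obj C"
    and terminal: "terminal_object D (Omap F T)"
  shows "terminal_object C T"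
proof -
  interpret covariant_functor C D F
    using sep by (simp add: separable_functor_def)
  show ?thesis
    using separable_functor_reflects_unique_arrow[OF sep _ T] terminal T Omap_closed
    by (simp add: terminal_object_def)
qed

theorem proposition24:
  fixes C :: "('o, 'a) cat" and D :: "('p, 'b) cat"
    and F :: "('o, 'a, 'p, 'b) fctr" and I Z T :: 'o
  assumes "separable_functor C D F"
    and "I \<in> Obj C" and "Z \<in> Obj C" and "T \<in> Obj C"
  shows "(initial_object D (Omap F I) \<longrightarrow> initial_object C I) \<and>
         (terminal_object D (Omap F T) \<longrightarrow> terminal_object C T) \<and>
         (zero_object D (Omap F Z) \<longrightarrow> zero_object C Z)"
  unfolding zero_object_def
  using separable_functor_reflects_initial_object[OF assms(1,2)]
    separable_functor_reflects_initial_object[OF assms(1,3)]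
    separable_functor_reflects_terminal_object[OF assms(1,3)]
    separable_functor_reflects_terminal_object[OF assms(1,4)]
  by simp

end
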